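(* Let $G$ be a digraph, and let $\overrightarrow{K_n}$ denote the transitive tournament on $n$ vertices. Then $\overrightarrow{\mathrm{Hom}}(G,\overrightarrow{K_n})$ is either empty or collapsible.
   Context: A digraph $G$ consists of a finite vertex set $V(G)$ and an edge set $E(G)\subseteq V(G)\times V(G)$ (loops are allowed, and $(v,w)$ and $(w,v)$ may both be edges). $\overrightarrow{K_n}$ is the digraph with vertex set $[n]=\{1,\dots,n\}$ and edges $(i,j)$ for all $i<j$. A multihomomorphism from $G$ to $H$ is a map $\alpha: V(G)\to 2^{V(H)}\setminus\{\emptyset\}$ such that $\alpha(v)\times\alpha(w)\subseteq E(H)$ for every $(v,w)\in E(G)$. $\overrightarrow{\mathrm{Hom}}(G,H)$ is the polyhedral subcomplex of $\prod_{x\in V(G)}\Delta^{V(H)}$ (where $\Delta^{S}$ is the simplex with vertex set $S$) whose cells are the products $\prod_{x}\Delta^{\alpha(x)}$ over all multihomomorphisms $\alpha$; its face poset is the set of multihomomorphisms ordered by pointwise inclusion. A polyhedral complex is collapsible if it can be reduced to a single vertex by a sequence of collapses; an (elementary) collapse removes a pair of cells $\tau\subsetneq\sigma$ with $\dim\tau=\dim\sigma-1$, where $\sigma$ is the only cell properly containing $\tau$. Equivalently, its face poset (of nonempty cells) admits an acyclic matching along covering relations whose only unmatched cell is one vertex. *)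

theory Defs
  imports Complex_Main "HOL-Library.FuncSet" "HOL-Library.Function_Algebras"
    "Graph_Theory.Pair_Digraph"
begin

text \<open>Spaces of functions as real vector spaces with pointwise operations: the complexes below
  consist of sets of points in \<open>'a \<Rightarrow> 'b \<Rightarrow> real\<close>.\<close>

instantiation "fun" :: (type, real_vector) real_vector
begin

definition scaleR_fun :: "real \<Rightarrow> ('a \<Rightarrow> 'b) \<Rightarrow> 'a \<Rightarrow> 'b" where
  "scaleR_fun c f = (\<lambda>x. c *\<^sub>R f x)"

instance
  by standard (simp_all add: scaleR_fun_def fun_eq_iff scaleR_add_right scaleR_add_left)

end

text \<open>The dimension of a cell is the dimension of its affine hull, i.e. of the linear span of the
  differences of its points. A complex is represented by its set of nonempty cells, each cell being
  a set of points, so that the face relation is inclusion.\<close>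

definition cell_dim :: "'e::real_vector set \<Rightarrow> nat" where
  "cell_dim S = dim {p - q | p q. p \<in> S \<and> q \<in> S}"

text \<open>\<open>elementary_collapse K L\<close>: the complex \<open>L\<close> arises from \<open>K\<close> by removing a free face \<open>\<tau>\<close>
  together with the unique cell \<open>\<sigma>\<close> properly containing it.\<close>

definition elementary_collapse :: "'e::real_vector set set \<Rightarrow> 'e set set \<Rightarrow> bool" where
  "elementary_collapse K L \<longleftrightarrow>
     (\<exists>\<tau>\<in>K. \<exists>\<sigma>\<in>K. \<tau> \<subset> \<sigma> \<and> cell_dim \<sigma> = cell_dim \<tau> + 1 \<and>
        (\<forall>\<rho>\<in>K. \<tau> \<subset> \<rho> \<longrightarrow> \<rho> = \<sigma>) \<and> L = K - {\<tau>, \<sigma>})"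

definition collapsible :: "'e::real_vector set set \<Rightarrow> bool" where
  "collapsible K \<longleftrightarrow> (\<exists>v. elementary_collapse\<^sup>*\<^sup>* K {{v}})"

text \<open>The simplex with (finite) vertex set \<open>S\<close>, in barycentric coordinates. With the coordinates
  outside \<open>S\<close> fixed to \<open>0\<close>, the simplex on a subset of \<open>S\<close> is literally a face of it.\<close>

definition simplex_on :: "'b set \<Rightarrow> ('b \<Rightarrow> real) set" where
  "simplex_on S = {t. (\<forall>y. 0 \<le> t y) \<and> (\<forall>y. y \<notin> S \<longrightarrow> t y = 0) \<and> (\<Sum>y\<in>S. t y) = 1}"

definition multihom :: "'a pair_pre_digraph \<Rightarrow> 'b pair_pre_digraph \<Rightarrow> ('a \<Rightarrow> 'b set) set" where
  "multihom G H =
     {\<alpha> \<in> pverts G \<rightarrow>\<^sub>E (Pow (pverts H) - {{}}). \<forall>(v, w) \<in> parcs G. \<alpha> v \<times> \<alpha> w \<subseteq> parcs H}"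

definition Hom_complex ::
  "'a pair_pre_digraph \<Rightarrow> 'b pair_pre_digraph \<Rightarrow> ('a \<Rightarrow> 'b \<Rightarrow> real) set set" where
  "Hom_complex G H = {(\<Pi>\<^sub>E x\<in>pverts G. simplex_on (\<alpha> x)) | \<alpha>. \<alpha> \<in> multihom G H}"

definition transitive_tournament :: "nat \<Rightarrow> nat pair_pre_digraph" where
  "transitive_tournament n =
     \<lparr> pverts = {1..n}, parcs = {(i, j). i \<in> {1..n} \<and> j \<in> {1..n} \<and> i < j} \<rparr>"

end

theory Submission
  imports Defs
begin

text \<open>Among all multihomomorphisms from \<open>G\<close> to the transitive tournament there is a pointwise
  least vertex choice \<open>m\<close>: let \<open>m x\<close> be the least number that occurs in any \<open>\<alpha> x\<close>. Along an arc
  \<open>(u, x)\<close> every element of \<open>\<alpha> u\<close> lies below every element of \<open>\<alpha> x\<close>, so \<open>m u < m x\<close>, and \<open>m\<close>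
  itself is a homomorphism. This single vertex is what the complex collapses to.

  The collapse runs through the vertices of \<open>G\<close> by increasing \<open>m\<close>. Once all vertices \<open>u\<close> with a
  smaller \<open>m u\<close> carry only \<open>{m u}\<close>, the number \<open>m x\<close> can be inserted into any \<open>\<alpha> x\<close>
  without leaving the complex: the in-neighbours of \<open>x\<close> lie below \<open>m x\<close> because they are already
  fixed, and the out-neighbours lie above because \<open>m x\<close> is at most the elements of \<open>\<alpha> x\<close>. So
  the cells with \<open>\<alpha> x \<noteq> {m x}\<close> are paired by inserting or deleting \<open>m x\<close> at \<open>x\<close>. Removing the
  pairs with the largest smaller member first makes each removal an elementary collapse
  (\<open>collapse_to_fixed_value\<close>) and leaves the subcomplex where \<open>\<alpha> x = {m x}\<close>.

  To pass from labels \<open>\<alpha>\<close> to the cells as sets of points, two facts suffice: inclusion of cells is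
  pointwise inclusion of labels (\<open>simplex_product_subset_iff\<close>), and inserting one new element in
  one factor raises the dimension by one (\<open>cell_dim_simplex_product_insert\<close>).\<close>

section \<open>Products of simplices\<close>

definition simplex_product :: "'a set \<Rightarrow> ('a \<Rightarrow> 'b set) \<Rightarrow> ('a \<Rightarrow> 'b \<Rightarrow> real) set" where
  "simplex_product V \<alpha> = (\<Pi>\<^sub>E x\<in>V. simplex_on (\<alpha> x))"

text \<open>The nonempty faces of a product of simplices on \<open>W\<close>, one factor for each element of \<open>V\<close>,
  correspond to these set-valued maps. They have a default value outside \<open>V\<close>, so a face determines
  its label.\<close>

definition labels :: "'a set \<Rightarrow> 'b set \<Rightarrow> ('a \<Rightarrow> 'b set) set" where
  "labels V W = V \<rightarrow>\<^sub>E (Pow W - {{}})"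

definition corner :: "'b \<Rightarrow> 'b \<Rightarrow> real" where
  "corner y = (\<lambda>z. of_bool (z = y))"

lemma corner_in_simplex:
  assumes "finite S" "y \<in> S"
  shows "corner y \<in> simplex_on S"
proof -
  have "(\<Sum>z\<in>S. corner y z) = 1"
    using assms by (simp add: corner_def of_bool_def)
  then show ?thesis
    using assms(2) by (auto simp: simplex_on_def corner_def)
qed

lemma simplex_on_singleton: "simplex_on {y} = {corner y}"
proof -
  have "t = corner y" if "t \<in> simplex_on {y}" for t
    using that by (intro ext) (simp add: simplex_on_def corner_def)
  then show ?thesis
    using corner_in_simplex[of "{y}" y] by blast
qed

lemma simplex_on_mono:
  assumes "finite T" "S \<subseteq> T"
  shows "simplex_on S \<subseteq> simplex_on T"
proof
  fix t assume t: "t \<in> simplex_on S"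
  have "(\<Sum>y\<in>T. t y) = (\<Sum>y\<in>S. t y)"
    by (rule sum.mono_neutral_right) (use assms t in \<open>auto simp: simplex_on_def\<close>)
  then show "t \<in> simplex_on T"
    using t assms by (auto simp: simplex_on_def)
qed

lemma simplex_on_subset_iff:
  assumes "finite S" "finite T"
  shows "simplex_on S \<subseteq> simplex_on T \<longleftrightarrow> S \<subseteq> T"
proof
  assume sub: "simplex_on S \<subseteq> simplex_on T"
  show "S \<subseteq> T"
  proof
    fix y assume "y \<in> S"
    then have "corner y \<in> simplex_on T"
      using corner_in_simplex[OF assms(1)] subsetD[OF sub] by simp
    then have "\<forall>z. z \<notin> T \<longrightarrow> corner y z = 0"
      by (simp add: simplex_on_def)
    then show "y \<in> T"
      by (metis corner_def of_bool_eq_0_iff)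
  qed
qed (use assms simplex_on_mono in blast)

lemma labelsD:
  assumes "\<alpha> \<in> labels V W" "x \<in> V"
  shows "\<alpha> x \<subseteq> W" "\<alpha> x \<noteq> {}"
  using PiE_mem[OF assms[unfolded labels_def]] by auto

lemma simplex_product_nonempty:
  assumes "finite W" "\<alpha> \<in> labels V W"
  shows "simplex_product V \<alpha> \<noteq> {}"
proof -
  have "simplex_on (\<alpha> x) \<noteq> {}" if x: "x \<in> V" for x
  proof -
    obtain y where "y \<in> \<alpha> x" using labelsD(2)[OF assms(2) x] by (auto simp: ex_in_conv)
    moreover have "finite (\<alpha> x)" by (rule finite_subset[OF labelsD(1)[OF assms(2) x] assms(1)])
    ultimately show ?thesis using corner_in_simplex by (metis empty_iff)
  qed
  then show ?thesis
    by (simp add: simplex_product_def PiE_eq_empty_iff)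
qed

lemma simplex_product_subset_iff:
  assumes "finite W" "\<alpha> \<in> labels V W" "\<beta> \<in> labels V W"
  shows "simplex_product V \<alpha> \<subseteq> simplex_product V \<beta> \<longleftrightarrow> \<alpha> \<le> \<beta>"
proof -
  have fin: "finite (\<alpha> x)" "finite (\<beta> x)" if x: "x \<in> V" for x
    using finite_subset[OF labelsD(1)[OF assms(2) x] assms(1)]
      finite_subset[OF labelsD(1)[OF assms(3) x] assms(1)] by simp_all
  have "simplex_product V \<alpha> \<subseteq> simplex_product V \<beta> \<longleftrightarrow> (\<forall>x\<in>V. \<alpha> x \<subseteq> \<beta> x)"
    using simplex_product_nonempty[OF assms(1,2)] fin
    by (simp add: simplex_product_def subset_PiE simplex_on_subset_iff)
  also have "\<dots> \<longleftrightarrow> \<alpha> \<le> \<beta>"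
    \<comment> \<open>Outside \<open>V\<close> both labels take the same default value, so the order on all functions may be
      used.\<close>
    using PiE_arb[OF assms(2)[unfolded labels_def]] PiE_arb[OF assms(3)[unfolded labels_def]]
    unfolding le_fun_def by (metis order_refl)
  finally show ?thesis .
qed

lemma simplex_product_inj:
  assumes "finite W"
  shows "inj_on (simplex_product V) (labels V W)"
  by (rule inj_onI) (metis antisym assms order_refl simplex_product_subset_iff)

section \<open>The dimension of a product of simplices\<close>

text \<open>The ambient function space may have infinite dimension, where \<open>dim\<close> is the cardinality of a
  basis and so \<open>0\<close> when a basis is infinite. The finite set \<open>E\<close> keeps the basis of \<open>D\<close> finite.\<close>

lemma dim_insert_generator:
  fixes D D' :: "'e::real_vector set"
  assumes "D \<subseteq> D'" "w \<in> D'" "w \<notin> span D" "D' \<subseteq> span (insert w D)"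
    and "finite E" "D \<subseteq> span E"
  shows "dim D' = dim D + 1"
proof -
  obtain B where B: "B \<subseteq> D" "independent B" "D \<subseteq> span B" "card B = dim D"
    by (rule real_vector.basis_exists)
  have finB: "finite B"
    using real_vector.independent_span_bound[OF assms(5) B(2)] B(1) assms(6) by blast
  have span: "span B = span D"
    using B by (metis real_vector.span_eq real_vector.span_superset subset_trans)
  have w: "w \<notin> span B" "w \<notin> B"
    using assms(3) span real_vector.span_base by auto
  show ?thesis
  proof (rule real_vector.dim_unique)
    show "insert w B \<subseteq> D'" using B assms by auto
    show "independent (insert w B)"
      by (rule real_vector.independent_insertI[OF w(1) B(2)])
    show "card (insert w B) = dim D + 1" using finB w B by simp
    have "insert w D \<subseteq> span (insert w B)"
      using B(3) real_vector.span_mono[of B "insert w B"] real_vector.span_base by blast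
    then show "D' \<subseteq> span (insert w B)"
      using assms(4) real_vector.span_minimal real_vector.subspace_span by blast
  qed
qed

definition coordinate_vector :: "'a \<Rightarrow> 'b \<Rightarrow> 'a \<Rightarrow> 'b \<Rightarrow> real" where
  "coordinate_vector x y = (\<lambda>v z. of_bool (v = x \<and> z = y))"

lemma sum_apply2:
  fixes f :: "'i \<Rightarrow> 'a \<Rightarrow> 'b \<Rightarrow> 'c::comm_monoid_add"
  shows "(\<Sum>i\<in>A. f i) v z = (\<Sum>i\<in>A. f i v z)"
  by (induction A rule: infinite_finite_induct) (auto simp: zero_fun_def plus_fun_def)

text \<open>This supplies the finite spanning set for the directions of a cell: a difference of two points
  has coordinate \<open>0\<close> outside the label, and also outside \<open>V\<close>, where both points have the same
  default value.\<close>

lemma simplex_product_differences_in_span: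
  fixes \<alpha> :: "'a \<Rightarrow> 'b set"
  assumes "finite V" "\<And>x. x \<in> V \<Longrightarrow> finite (\<alpha> x)"
    and p: "p \<in> simplex_product V \<alpha>" and q: "q \<in> simplex_product V \<alpha>"
  shows "p - q \<in> span ((\<lambda>(x, y). coordinate_vector x y) ` Sigma V \<alpha>)"
proof -
  have zero: "(p - q) v z = 0" if "(v, z) \<notin> Sigma V \<alpha>" for v z
  proof (cases "v \<in> V")
    case True
    then have "p v \<in> simplex_on (\<alpha> v)" "q v \<in> simplex_on (\<alpha> v)"
      using p q by (auto simp: simplex_product_def)
    then show ?thesis
      using that True by (auto simp: simplex_on_def)
  next
    case False
    then show ?thesis
      using p q by (auto simp: simplex_product_def PiE_def extensional_def)
  qed
  have fin: "finite (Sigma V \<alpha>)" using assms by auto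
  have "p - q = (\<Sum>i\<in>Sigma V \<alpha>. (p - q) (fst i) (snd i) *\<^sub>R coordinate_vector (fst i) (snd i))"
  proof (intro ext)
    fix v z
    have "(\<Sum>i\<in>Sigma V \<alpha>. (p - q) (fst i) (snd i) *\<^sub>R coordinate_vector (fst i) (snd i)) v z
        = (\<Sum>i\<in>Sigma V \<alpha>. if i = (v, z) then (p - q) v z else 0)"
      unfolding sum_apply2 scaleR_fun_def
      by (rule sum.cong) (auto simp: coordinate_vector_def)
    also have "\<dots> = (p - q) v z"
      using zero fin by (cases "(v, z) \<in> Sigma V \<alpha>") (auto simp: sum.delta)
    finally show "(p - q) v z =
      (\<Sum>i\<in>Sigma V \<alpha>. (p - q) (fst i) (snd i) *\<^sub>R coordinate_vector (fst i) (snd i)) v z" by simp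
  qed
  also have "\<dots> \<in> span ((\<lambda>(x, y). coordinate_vector x y) ` Sigma V \<alpha>)"
    by (intro real_vector.span_sum real_vector.span_scale real_vector.span_base) force
  finally show ?thesis .
qed

lemma simplex_on_move_mass:
  assumes "finite S" "b \<in> S" "y \<notin> S" "t \<in> simplex_on (insert y S)"
  shows "t(y := 0, b := t b + t y) \<in> simplex_on S"
proof -
  have "(\<Sum>z\<in>S. (t(y := 0, b := t b + t y)) z) = t b + t y + (\<Sum>z\<in>S - {b}. t z)"
  proof -
    have "(\<Sum>z\<in>S - {b}. (t(y := 0, b := t b + t y)) z) = (\<Sum>z\<in>S - {b}. t z)"
      using assms(3) by (intro sum.cong) auto
    then show ?thesis
      using sum.remove[OF assms(1,2), of "t(y := 0, b := t b + t y)"] by simp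
  qed
  also have "\<dots> = (\<Sum>z\<in>insert y S. t z)"
    using assms by (simp add: sum.remove[of S b])
  also have "\<dots> = 1" using assms by (simp add: simplex_on_def)
  finally show ?thesis
    using assms by (auto simp: simplex_on_def)
qed

text \<open>Moving the weight of the new corner \<open>y\<close> to an old corner \<open>b\<close> of the same factor sends the
  large cell onto the small one, and changes a point by a multiple of the edge vector from \<open>b\<close> to
  \<open>y\<close>. So this edge vector is the only direction gained; it is a new one because all directions of
  the small cell vanish at the coordinate \<open>y\<close>.\<close>

lemma cell_dim_simplex_product_insert:
  fixes \<alpha> :: "'a \<Rightarrow> 'b set"
  assumes V: "finite V" and W: "finite W" and \<alpha>: "\<alpha> \<in> labels V W"
    and x: "x \<in> V" and y: "y \<notin> \<alpha> x"
  shows "cell_dim (simplex_product V (\<alpha>(x := insert y (\<alpha> x)))) = cell_dim (simplex_product V \<alpha>) + 1"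
proof -
  define \<beta> where "\<beta> = \<alpha>(x := insert y (\<alpha> x))"
  have fin: "finite (\<alpha> v)" if "v \<in> V" for v
    using labelsD[OF \<alpha> that] W finite_subset by blast
  then have fin\<beta>: "finite (\<beta> v)" if "v \<in> V" for v
    using that x by (auto simp: \<beta>_def)
  obtain b where b: "b \<in> \<alpha> x" using labelsD[OF \<alpha> x] by blast
  have by_ne: "b \<noteq> y" using b y by auto
  define w where "w = coordinate_vector x y - coordinate_vector x b"
  define D where "D = {p - q | p q. p \<in> simplex_product V \<alpha> \<and> q \<in> simplex_product V \<alpha>}"
  define D' where "D' = {p - q | p q. p \<in> simplex_product V \<beta> \<and> q \<in> simplex_product V \<beta>}"
  have sub: "simplex_product V \<alpha> \<subseteq> simplex_product V \<beta>"
    unfolding simplex_product_def using fin\<beta>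
    by (intro PiE_mono simplex_on_mono) (auto simp: \<beta>_def)
  have "dim D' = dim D + 1"
  proof (rule dim_insert_generator)
    show "D \<subseteq> D'" using sub unfolding D_def D'_def by blast
    obtain p where p: "p \<in> simplex_product V \<alpha>"
      using simplex_product_nonempty[OF W \<alpha>] by blast
    have c: "p(x := corner z) \<in> simplex_product V \<beta>" if "z \<in> \<beta> x" for z
      using p sub corner_in_simplex[OF fin\<beta>[OF x] that] x
      by (auto simp: simplex_product_def PiE_def Pi_def extensional_def)
    have "w = p(x := corner y) - p(x := corner b)"
      by (auto simp: w_def coordinate_vector_def corner_def fun_eq_iff)
    then show "w \<in> D'"
      using c[of y] c[of b] b unfolding D'_def \<beta>_def by auto
    have "subspace {d :: 'a \<Rightarrow> 'b \<Rightarrow> real. d x y = 0}"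
      by (auto simp: real_vector.subspace_def scaleR_fun_def)
    moreover have "D \<subseteq> {d. d x y = 0}"
    proof -
      have "p x y = 0" if "p \<in> simplex_product V \<alpha>" for p
        using PiE_mem[OF that[unfolded simplex_product_def] x] y unfolding simplex_on_def by blast
      then have "(p - q) x y = 0" if "p \<in> simplex_product V \<alpha>" "q \<in> simplex_product V \<alpha>" for p q
        using that by (metis diff_self minus_apply)
      then show ?thesis unfolding D_def by blast
    qed
    ultimately have "span D \<subseteq> {d. d x y = 0}"
      by (rule real_vector.span_minimal[rotated])
    moreover have "w x y = 1"
      using by_ne by (auto simp: w_def coordinate_vector_def)
    ultimately show "w \<notin> span D" by auto
    define r :: "('a \<Rightarrow> 'b \<Rightarrow> real) \<Rightarrow> 'a \<Rightarrow> 'b \<Rightarrow> real"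
      where "r p = p(x := (p x)(y := 0, b := p x b + p x y))" for p
    have r: "r p \<in> simplex_product V \<alpha>" if p: "p \<in> simplex_product V \<beta>" for p
    proof -
      have "p x \<in> simplex_on (insert y (\<alpha> x))"
        using PiE_mem[OF p[unfolded simplex_product_def] x] by (simp add: \<beta>_def)
      then have "(p x)(y := 0, b := p x b + p x y) \<in> simplex_on (\<alpha> x)"
        by (rule simplex_on_move_mass[OF fin[OF x] b y])
      then show ?thesis
        using p x unfolding r_def simplex_product_def \<beta>_def
        by (auto simp: PiE_def Pi_def extensional_def split: if_splits)
    qed
    \<comment> \<open>\<open>r\<close> moves the weight at \<open>y\<close> to \<open>b\<close>, so \<open>p - r p\<close> is \<open>p x y\<close> times the edge vector \<open>w\<close>.\<close>
    have decomp: "p - q = (r p - r q) + (p x y - q x y) *\<^sub>R w" for p q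
      using by_ne
      by (auto simp: r_def w_def coordinate_vector_def scaleR_fun_def fun_eq_iff)
    show "D' \<subseteq> span (insert w D)"
    proof
      fix d assume "d \<in> D'"
      then obtain p q where pq: "p \<in> simplex_product V \<beta>" "q \<in> simplex_product V \<beta>" "d = p - q"
        unfolding D'_def by blast
      have "r p - r q \<in> D" using r pq unfolding D_def by blast
      then show "d \<in> span (insert w D)"
        unfolding pq(3) decomp[of p q]
        by (intro real_vector.span_add real_vector.span_scale real_vector.span_base) auto
    qed
    show "finite ((\<lambda>(x, y). coordinate_vector x y) ` Sigma V \<alpha>)"
      using V fin by auto
    show "D \<subseteq> span ((\<lambda>(x, y). coordinate_vector x y) ` Sigma V \<alpha>)"
      using simplex_product_differences_in_span[OF V fin] unfolding D_def by auto
  qed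
  then show ?thesis
    by (simp add: cell_dim_def D_def D'_def \<beta>_def)
qed

section \<open>Collapsing onto a fixed value at one coordinate\<close>

text \<open>The cells that do not have \<open>{y}\<close> at \<open>x\<close> come in pairs, without and with \<open>y\<close>. A pair whose
  smaller member \<open>\<tau>\<close> is maximal can be removed first: a cell \<open>\<rho>\<close> strictly above \<open>\<tau>\<close> contains \<open>y\<close>
  at \<open>x\<close> by maximality, and deleting \<open>y\<close> from it gives a cell above \<open>\<tau>\<close> without \<open>y\<close>, which must be
  \<open>\<tau>\<close> again; hence \<open>\<rho>\<close> is the partner of \<open>\<tau>\<close>. The remaining set is again closed under
  faces and under inserting \<open>y\<close>, because none of its members lies above \<open>\<tau>\<close>.\<close>

lemma collapse_to_fixed_value:
  fixes S :: "('a \<Rightarrow> 'b set) set"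
  assumes V: "finite V" and W: "finite W" and x: "x \<in> V"
    and "S \<subseteq> labels V W"
    and "\<And>\<alpha> \<beta>. \<beta> \<in> S \<Longrightarrow> \<alpha> \<in> labels V W \<Longrightarrow> \<alpha> \<le> \<beta> \<Longrightarrow> \<alpha> \<in> S"
    and "\<And>\<alpha>. \<alpha> \<in> S \<Longrightarrow> \<alpha>(x := insert y (\<alpha> x)) \<in> S"
  shows "elementary_collapse\<^sup>*\<^sup>* (simplex_product V ` S)
           (simplex_product V ` {\<alpha> \<in> S. \<alpha> x = {y}})"
  using assms(4-6)
proof (induction "card S" arbitrary: S rule: less_induct)
  case (less S)
  note sub = less.prems(1) and down = less.prems(2) and ins = less.prems(3)
  have "finite (labels V W)"
    unfolding labels_def using V W by (intro finite_PiE) auto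
  then have finS: "finite S" using sub finite_subset by blast
  have deletion: "\<alpha>(x := \<alpha> x - {y}) \<in> S" if "\<alpha> \<in> S" "\<alpha> x \<noteq> {y}" for \<alpha>
  proof (rule down[OF that(1)])
    have "\<alpha> x \<noteq> {}" "\<alpha> x \<subseteq> W" using labelsD[of \<alpha> V W] sub that x by auto
    then show "\<alpha>(x := \<alpha> x - {y}) \<in> labels V W"
      using that sub x by (auto simp: labels_def PiE_def Pi_def extensional_def)
    show "\<alpha>(x := \<alpha> x - {y}) \<le> \<alpha>" by (auto simp: le_fun_def)
  qed
  show ?case
  proof (cases "\<forall>\<alpha>\<in>S. \<alpha> x = {y}")
    case True
    then have "{\<alpha> \<in> S. \<alpha> x = {y}} = S" by blast
    then show ?thesis by simp
  next
    case False
    define F where "F = {\<alpha> \<in> S. y \<notin> \<alpha> x}"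
    have "F \<noteq> {}" using False deletion unfolding F_def by fastforce
    moreover have "finite F" unfolding F_def using finS by simp
    ultimately obtain \<tau> where \<tau>F: "\<tau> \<in> F" and max: "\<And>\<alpha>. \<alpha> \<in> F \<Longrightarrow> \<tau> \<le> \<alpha> \<Longrightarrow> \<alpha> = \<tau>"
      using finite_has_maximal[of F] by metis
    have \<tau>: "\<tau> \<in> S" "y \<notin> \<tau> x" using \<tau>F unfolding F_def by auto
    have \<tau>ne: "\<tau> x \<noteq> {}" using labelsD[of \<tau> V W x] sub \<tau> x by auto
    define \<sigma> where "\<sigma> = \<tau>(x := insert y (\<tau> x))"
    have \<sigma>: "\<sigma> \<in> S" unfolding \<sigma>_def using ins \<tau> by blast
    have \<tau>\<sigma>: "\<tau> \<le> \<sigma>" "\<tau> \<noteq> \<sigma>"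
      using \<tau> by (auto simp: \<sigma>_def le_fun_def fun_eq_iff)
    \<comment> \<open>The nonempty set \<open>\<tau> x\<close> lies inside \<open>\<rho> x\<close> and avoids \<open>y\<close>, so deleting \<open>y\<close> from \<open>\<rho>\<close> leaves a nonempty
      value at \<open>x\<close>.\<close>
    have free: "\<rho> = \<sigma>" if \<rho>: "\<rho> \<in> S" "\<tau> \<le> \<rho>" "\<rho> \<noteq> \<tau>" for \<rho>
    proof -
      have y\<rho>: "y \<in> \<rho> x" using max[of \<rho>] \<rho> unfolding F_def by blast
      have le: "\<tau> \<le> \<rho>(x := \<rho> x - {y})"
        using \<rho>(2) \<tau> by (auto simp: le_fun_def)
      have "\<tau> x \<subseteq> \<rho> x" using \<rho>(2) by (auto simp: le_fun_def)
      then have "\<rho> x \<noteq> {y}" using \<tau>ne \<tau>(2) by auto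
      then have "\<rho>(x := \<rho> x - {y}) \<in> F"
        using deletion \<rho> unfolding F_def by auto
      then have "\<rho>(x := \<rho> x - {y}) = \<tau>" using max le by blast
      then have "\<tau>(x := insert y (\<tau> x)) = \<rho>(x := insert y (\<rho> x - {y}))" by auto
      then have "\<tau>(x := insert y (\<tau> x)) = \<rho>" using y\<rho> by (simp add: insert_absorb)
      then show "\<rho> = \<sigma>" by (simp add: \<sigma>_def)
    qed
    define S' where "S' = S - {\<tau>, \<sigma>}"
    have step: "elementary_collapse (simplex_product V ` S) (simplex_product V ` S')"
      unfolding elementary_collapse_def
    proof (rule bexI[of _ "simplex_product V \<tau>"], rule bexI[of _ "simplex_product V \<sigma>"],
        intro conjI ballI impI)
      show "simplex_product V \<tau> \<in> simplex_product V ` S"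
        "simplex_product V \<sigma> \<in> simplex_product V ` S" using \<tau> \<sigma> by auto
      have iff: "simplex_product V \<alpha> \<subseteq> simplex_product V \<beta> \<longleftrightarrow> \<alpha> \<le> \<beta>"
        if "\<alpha> \<in> S" "\<beta> \<in> S" for \<alpha> \<beta>
        using simplex_product_subset_iff[OF W] that sub by blast
      show "simplex_product V \<tau> \<subset> simplex_product V \<sigma>"
        using iff \<tau> \<sigma> \<tau>\<sigma> by (metis antisym order_refl psubsetI)
      show "cell_dim (simplex_product V \<sigma>) = cell_dim (simplex_product V \<tau>) + 1"
        unfolding \<sigma>_def
        by (rule cell_dim_simplex_product_insert[where W = W]) (use V W x \<tau> sub in auto)
      fix P assume "P \<in> simplex_product V ` S" "simplex_product V \<tau> \<subset> P"
      then show "P = simplex_product V \<sigma>"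
        using free iff \<tau> by blast
    next
      show "simplex_product V ` S' = simplex_product V ` S - {simplex_product V \<tau>, simplex_product V \<sigma>}"
      proof -
        have "simplex_product V ` S' = simplex_product V ` S - simplex_product V ` {\<tau>, \<sigma>}"
          unfolding S'_def
          by (rule inj_on_image_set_diff[OF simplex_product_inj[OF W]]) (use sub \<tau> \<sigma> in blast)+
        then show ?thesis by simp
      qed
    qed
    have "elementary_collapse\<^sup>*\<^sup>* (simplex_product V ` S')
           (simplex_product V ` {\<alpha> \<in> S'. \<alpha> x = {y}})"
    proof (rule less.hyps)
      show "card S' < card S"
        unfolding S'_def using finS \<tau> by (intro psubset_card_mono) auto
      show "S' \<subseteq> labels V W" using sub S'_def by auto
      show "\<alpha> \<in> S'" if "\<beta> \<in> S'" "\<alpha> \<in> labels V W" "\<alpha> \<le> \<beta>" for \<alpha> \<beta>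
      proof -
        have "\<alpha> \<in> S" using down that S'_def by auto
        moreover have "\<not> \<tau> \<le> \<beta>" using free that(1) unfolding S'_def by blast
        ultimately show ?thesis
          using that(3) \<tau>\<sigma>(1) unfolding S'_def by (auto intro: order_trans)
      qed
      show "\<alpha>(x := insert y (\<alpha> x)) \<in> S'" if \<alpha>: "\<alpha> \<in> S'" for \<alpha>
      proof -
        have "\<not> \<tau> \<le> \<alpha>" using free \<alpha> unfolding S'_def by blast
        then have "\<not> \<tau> \<le> \<alpha>(x := insert y (\<alpha> x))"
          using \<tau>(2) by (auto simp: le_fun_def split: if_splits)
        then show ?thesis
          using \<tau>\<sigma>(1) ins \<alpha> unfolding S'_def by auto
      qed
    qed
    moreover have "{\<alpha> \<in> S'. \<alpha> x = {y}} = {\<alpha> \<in> S. \<alpha> x = {y}}"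
      using \<tau> \<tau>ne by (auto simp: S'_def \<sigma>_def)
    ultimately show ?thesis
      using step by (simp add: converse_rtranclp_into_rtranclp)
  qed
qed

section \<open>Multihomomorphisms to the transitive tournament\<close>

lemma multihom_subset_labels: "multihom G H \<subseteq> labels (pverts G) (pverts H)"
  unfolding multihom_def labels_def by blast

lemma Hom_complex_eq: "Hom_complex G H = simplex_product (pverts G) ` multihom G H"
  unfolding Hom_complex_def simplex_product_def by blast

lemma multihom_mono:
  assumes "\<beta> \<in> multihom G H" "\<alpha> \<in> labels (pverts G) (pverts H)" "\<alpha> \<le> \<beta>"
  shows "\<alpha> \<in> multihom G H"
proof -
  have "\<alpha> v \<times> \<alpha> w \<subseteq> parcs H" if "(v, w) \<in> parcs G" for v w
  proof -
    have "\<alpha> v \<times> \<alpha> w \<subseteq> \<beta> v \<times> \<beta> w"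
      using le_funD[OF assms(3)] by (intro Sigma_mono) auto
    also have "\<dots> \<subseteq> parcs H"
      using assms(1) that unfolding multihom_def by blast
    finally show ?thesis .
  qed
  then show ?thesis using assms(2) unfolding multihom_def labels_def by blast
qed

lemma multihom_tournament_labels:
  "multihom G (transitive_tournament n) \<subseteq> labels (pverts G) {1..n}"
  using multihom_subset_labels[of G "transitive_tournament n"]
  by (simp add: transitive_tournament_def)

lemma multihom_tournamentD:
  assumes "\<alpha> \<in> multihom G (transitive_tournament n)" "x \<in> pverts G"
  shows "\<alpha> x \<subseteq> {1..n}" "\<alpha> x \<noteq> {}"
  using labelsD[OF subsetD[OF multihom_tournament_labels assms(1)] assms(2)] .

definition least_hom :: "'a pair_pre_digraph \<Rightarrow> nat \<Rightarrow> 'a \<Rightarrow> nat" where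
  "least_hom G n x = (LEAST k. \<exists>\<alpha>\<in>multihom G (transitive_tournament n). k \<in> \<alpha> x)"

lemma least_hom_le:
  assumes "\<alpha> \<in> multihom G (transitive_tournament n)" "k \<in> \<alpha> x"
  shows "least_hom G n x \<le> k"
  unfolding least_hom_def using assms by (auto intro: Least_le)

lemma least_hom_attained:
  assumes "\<alpha> \<in> multihom G (transitive_tournament n)" "x \<in> pverts G"
  obtains \<beta> where "\<beta> \<in> multihom G (transitive_tournament n)" "least_hom G n x \<in> \<beta> x"
proof -
  have "\<alpha> x \<noteq> {}"
    by (rule multihom_tournamentD[OF assms])
  then have "\<exists>k. \<exists>\<alpha>\<in>multihom G (transitive_tournament n). k \<in> \<alpha> x"
    using assms by blast
  then show ?thesis
    using LeastI_ex[of "\<lambda>k. \<exists>\<alpha>\<in>multihom G (transitive_tournament n). k \<in> \<alpha> x"] that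
    unfolding least_hom_def by blast
qed

lemma multihomI:
  assumes "\<alpha> \<in> labels (pverts G) {1..n}"
    and "\<And>v w. (v, w) \<in> parcs G \<Longrightarrow> \<alpha> v \<times> \<alpha> w \<subseteq> parcs (transitive_tournament n)"
  shows "\<alpha> \<in> multihom G (transitive_tournament n)"
proof -
  have "\<alpha> \<in> labels (pverts G) (pverts (transitive_tournament n))"
    using assms(1) by (simp add: transitive_tournament_def)
  then show ?thesis
    using assms(2) unfolding multihom_def labels_def by blast
qed

lemma least_hom_in_range:
  assumes "\<alpha> \<in> multihom G (transitive_tournament n)" "x \<in> pverts G"
  shows "least_hom G n x \<in> {1..n}"
proof -
  obtain \<beta> where "\<beta> \<in> multihom G (transitive_tournament n)" "least_hom G n x \<in> \<beta> x"
    by (rule least_hom_attained[OF assms])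
  then show ?thesis
    using multihom_tournamentD(1)[OF _ assms(2)] by blast
qed

lemma multihom_arc_less:
  assumes "\<alpha> \<in> multihom G (transitive_tournament n)" "(u, x) \<in> parcs G" "i \<in> \<alpha> u" "j \<in> \<alpha> x"
  shows "i < j"
proof -
  have "\<alpha> u \<times> \<alpha> x \<subseteq> parcs (transitive_tournament n)"
    using assms(1,2) unfolding multihom_def by blast
  then show ?thesis
    using assms(3,4) by (auto simp: transitive_tournament_def)
qed

text \<open>A multihomomorphism that attains the least value at \<open>x\<close> has only smaller numbers at \<open>u\<close>, and
  \<open>least_hom G n u\<close> is at most each of these.\<close>

lemma least_hom_arc_less:
  assumes "pair_wf_digraph G"
    and \<alpha>: "\<alpha> \<in> multihom G (transitive_tournament n)" and ux: "(u, x) \<in> parcs G"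
  shows "least_hom G n u < least_hom G n x"
proof -
  interpret pair_wf_digraph G by fact
  have uv: "u \<in> pverts G" "x \<in> pverts G"
    using ux in_arcsD1 in_arcsD2 by auto
  obtain \<beta> where \<beta>: "\<beta> \<in> multihom G (transitive_tournament n)" "least_hom G n x \<in> \<beta> x"
    by (rule least_hom_attained[OF \<alpha> uv(2)])
  obtain i where i: "i \<in> \<beta> u"
    using multihom_tournamentD(2)[OF \<beta>(1) uv(1)] by blast
  show ?thesis
    using least_hom_le[OF \<beta>(1) i] multihom_arc_less[OF \<beta>(1) ux i \<beta>(2)] by simp
qed

text \<open>Fixing the in-neighbours of \<open>x\<close> keeps them below the inserted value; the out-neighbours stay
  above it because it is at most the elements already present at \<open>x\<close>.\<close>

lemma multihom_insert_least_hom: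
  assumes wf: "pair_wf_digraph G"
    and \<alpha>: "\<alpha> \<in> multihom G (transitive_tournament n)" and x: "x \<in> pverts G"
    and fixed: "\<And>u. (u, x) \<in> parcs G \<Longrightarrow> \<alpha> u = {least_hom G n u}"
  shows "\<alpha>(x := insert (least_hom G n x) (\<alpha> x)) \<in> multihom G (transitive_tournament n)"
proof -
  interpret pair_wf_digraph G by fact
  define \<beta> where "\<beta> = \<alpha>(x := insert (least_hom G n x) (\<alpha> x))"
  have lab: "\<alpha> \<in> labels (pverts G) {1..n}"
    using \<alpha> multihom_tournament_labels by blast
  have lab\<beta>: "\<beta> \<in> labels (pverts G) {1..n}"
    using lab least_hom_in_range[OF \<alpha> x] x unfolding \<beta>_def labels_def
    by (auto simp: PiE_def Pi_def extensional_def)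
  have less: "i < j" if arc: "(v, w) \<in> parcs G" and i: "i \<in> \<beta> v" and j: "j \<in> \<beta> w" for v w i j
  proof -
    have v: "v \<in> pverts G" using arc in_arcsD1 by blast
    \<comment> \<open>The inserted value is bounded above by an old one, so \<open>i\<close> may be replaced by an old \<open>l\<close>.\<close>
    obtain l where l: "l \<in> \<alpha> v" "i \<le> l"
    proof (cases "i \<in> \<alpha> v")
      case True
      then show ?thesis using that by blast
    next
      case False
      then have "i = least_hom G n v" using i by (auto simp: \<beta>_def split: if_splits)
      moreover obtain l where "l \<in> \<alpha> v" using labelsD(2)[OF lab v] by blast
      ultimately show ?thesis using that least_hom_le[OF \<alpha>] by blast
    qed
    show "i < j"
    proof (cases "j \<in> \<alpha> w")
      case True
      then show ?thesis using multihom_arc_less[OF \<alpha> arc l(1)] l(2) by fastforce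
    next
      case False
      then have w: "w = x" "j = least_hom G n x" using j by (auto simp: \<beta>_def split: if_splits)
      then have "l = least_hom G n v" using fixed arc l by auto
      then show ?thesis using least_hom_arc_less[OF wf \<alpha> arc] l(2) w by simp
    qed
  qed
  have "\<beta> v \<times> \<beta> w \<subseteq> parcs (transitive_tournament n)" if arc: "(v, w) \<in> parcs G" for v w
  proof -
    have "\<beta> v \<subseteq> {1..n}" "\<beta> w \<subseteq> {1..n}"
      using labelsD(1)[OF lab\<beta>] in_arcsD1[OF arc] in_arcsD2[OF arc] by blast+
    then show ?thesis
      using less[OF arc] by (auto simp: transitive_tournament_def)
  qed
  then show ?thesis
    using lab\<beta> unfolding \<beta>_def[symmetric] by (intro multihomI)
qed

text \<open>The stages of the collapse are indexed by the set \<open>A\<close> of vertices already fixed. A vertex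
  outside \<open>A\<close> at which \<open>least_hom\<close> is smallest has all its in-neighbours in \<open>A\<close>, so it can be
  fixed next.\<close>

lemma collapse_from_fixed_set:
  assumes fin: "pair_fin_digraph G" and \<gamma>: "\<gamma> \<in> multihom G (transitive_tournament n)"
    and "A \<subseteq> pverts G"
  shows "elementary_collapse\<^sup>*\<^sup>*
    (simplex_product (pverts G) `
      {\<alpha> \<in> multihom G (transitive_tournament n). \<forall>u\<in>A. \<alpha> u = {least_hom G n u}})
    (simplex_product (pverts G) `
      {\<alpha> \<in> multihom G (transitive_tournament n). \<forall>u\<in>pverts G. \<alpha> u = {least_hom G n u}})"
  using assms(3)
proof (induction "card (pverts G - A)" arbitrary: A rule: less_induct)
  case (less A)
  interpret pair_fin_digraph G by (rule fin)
  let ?M = "multihom G (transitive_tournament n)"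
  define C where "C B = {\<alpha> \<in> ?M. \<forall>u\<in>B. \<alpha> u = {least_hom G n u}}" for B
  show ?case
  proof (cases "A = pverts G")
    case True
    then show ?thesis by simp
  next
    case False
    then have "pverts G - A \<noteq> {}" using less.prems by blast
    then obtain x where x: "x \<in> pverts G" "x \<notin> A"
      and min: "\<And>u. u \<in> pverts G - A \<Longrightarrow> least_hom G n x \<le> least_hom G n u"
      using finite_verts
      by (metis DiffE arg_min_if_finite(1) arg_min_least finite_Diff)
    have in_nb: "u \<in> A" if "(u, x) \<in> parcs G" for u
      using min[of u] least_hom_arc_less[OF pair_wf_digraph_axioms \<gamma> that] in_arcsD1[OF that]
      by force
    have "elementary_collapse\<^sup>*\<^sup>* (simplex_product (pverts G) ` C A)
      (simplex_product (pverts G) ` {\<alpha> \<in> C A. \<alpha> x = {least_hom G n x}})"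
    proof (rule collapse_to_fixed_value[where W = "{1..n}"])
      show "C A \<subseteq> labels (pverts G) {1..n}"
        unfolding C_def using multihom_tournament_labels by blast
      show "\<alpha> \<in> C A" if \<beta>: "\<beta> \<in> C A" and \<alpha>: "\<alpha> \<in> labels (pverts G) {1..n}" "\<alpha> \<le> \<beta>" for \<alpha> \<beta>
      proof -
        have "\<alpha> \<in> ?M"
          using multihom_mono[of \<beta> G "transitive_tournament n" \<alpha>] \<alpha> \<beta>
          by (simp add: C_def transitive_tournament_def)
        moreover have "\<alpha> u = {least_hom G n u}" if u: "u \<in> A" for u
        proof -
          have "\<alpha> u \<subseteq> {least_hom G n u}"
            using le_funD[OF \<alpha>(2), of u] \<beta> u by (simp add: C_def)
          moreover have "\<alpha> u \<noteq> {}"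
            using labelsD(2)[OF \<alpha>(1)] u less.prems by blast
          ultimately show ?thesis by blast
        qed
        ultimately show ?thesis by (simp add: C_def)
      qed
      show "\<alpha>(x := insert (least_hom G n x) (\<alpha> x)) \<in> C A" if "\<alpha> \<in> C A" for \<alpha>
        using that multihom_insert_least_hom[OF pair_wf_digraph_axioms _ x(1)] in_nb x(2)
        by (auto simp: C_def)
    qed (use x finite_verts in auto)
    also have "{\<alpha> \<in> C A. \<alpha> x = {least_hom G n x}} = C (insert x A)"
      by (auto simp: C_def)
    also have "elementary_collapse\<^sup>*\<^sup>* (simplex_product (pverts G) ` C (insert x A))
      (simplex_product (pverts G) ` C (pverts G))"
      unfolding C_def
    proof (rule less.hyps)
      show "card (pverts G - insert x A) < card (pverts G - A)"
        using x finite_verts by (intro psubset_card_mono) auto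
      show "insert x A \<subseteq> pverts G" using x less.prems by blast
    qed
    finally show ?thesis unfolding C_def .
  qed
qed

text \<open>The vertex of the complex that survives all collapses.\<close>

lemma least_hom_is_multihom:
  assumes "pair_wf_digraph G" and "\<gamma> \<in> multihom G (transitive_tournament n)"
  shows "(\<lambda>x\<in>pverts G. {least_hom G n x}) \<in> multihom G (transitive_tournament n)"
proof -
  interpret pair_wf_digraph G by fact
  have "(\<lambda>x\<in>pverts G. {least_hom G n x}) v \<times> (\<lambda>x\<in>pverts G. {least_hom G n x}) w
      \<subseteq> parcs (transitive_tournament n)" if arc: "(v, w) \<in> parcs G" for v w
    using least_hom_arc_less[OF assms arc] least_hom_in_range[OF assms(2)]
      in_arcsD1[OF arc] in_arcsD2[OF arc]
    by (simp add: transitive_tournament_def)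
  moreover have "(\<lambda>x\<in>pverts G. {least_hom G n x}) \<in> labels (pverts G) {1..n}"
    using least_hom_in_range[OF assms(2)] by (simp add: labels_def)
  ultimately show ?thesis by (intro multihomI)
qed

theorem theorem5p2:
  fixes G :: "'a pair_pre_digraph" and n :: nat
  assumes "pair_fin_digraph G"
  shows "Hom_complex G (transitive_tournament n) = {} \<or>
         collapsible (Hom_complex G (transitive_tournament n))"
proof (cases "multihom G (transitive_tournament n) = {}")
  case True
  then show ?thesis by (simp add: Hom_complex_eq)
next
  case False
  then obtain \<gamma> where \<gamma>: "\<gamma> \<in> multihom G (transitive_tournament n)" by blast
  interpret pair_fin_digraph G by fact
  define V where "V = pverts G"
  define \<mu> where "\<mu> = (\<lambda>x\<in>V. {least_hom G n x})"
  have "elementary_collapse\<^sup>*\<^sup>* (Hom_complex G (transitive_tournament n)) (simplex_product V `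
      {\<alpha> \<in> multihom G (transitive_tournament n). \<forall>u\<in>V. \<alpha> u = {least_hom G n u}})"
    using collapse_from_fixed_set[OF assms \<gamma>, of "{}"] by (simp add: Hom_complex_eq V_def)
  also have "{\<alpha> \<in> multihom G (transitive_tournament n). \<forall>u\<in>V. \<alpha> u = {least_hom G n u}} = {\<mu>}"
  proof -
    have "\<alpha> = \<mu>" if "\<alpha> \<in> multihom G (transitive_tournament n)"
      "\<forall>u\<in>V. \<alpha> u = {least_hom G n u}" for \<alpha>
    proof
      fix u
      have "\<alpha> \<in> labels V {1..n}"
        using that(1) multihom_tournament_labels unfolding V_def by blast
      then show "\<alpha> u = \<mu> u"
        using that(2) PiE_arb[of \<alpha> V _ u] unfolding labels_def \<mu>_def by (cases "u \<in> V") simp_all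
    qed
    moreover have "\<forall>u\<in>V. \<mu> u = {least_hom G n u}" by (simp add: \<mu>_def)
    ultimately show ?thesis
      using least_hom_is_multihom[OF pair_wf_digraph_axioms \<gamma>, folded V_def, folded \<mu>_def] by blast
  qed
  also have "simplex_product V ` {\<mu>} = {{\<lambda>x\<in>V. corner (least_hom G n x)}}"
  proof -
    have "simplex_product V \<mu> = (\<Pi>\<^sub>E x\<in>V. {(\<lambda>x\<in>V. corner (least_hom G n x)) x})"
      unfolding simplex_product_def \<mu>_def
      by (intro PiE_cong) (simp add: simplex_on_singleton)
    also have "\<dots> = {\<lambda>x\<in>V. corner (least_hom G n x)}"
      by (rule PiE_singleton) (rule restrict_extensional)
    finally show ?thesis by simp
  qed
  finally show ?thesis unfolding collapsible_def by blast
qed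

end
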